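(* Let $n\ge 2$, let $\Omega\subseteq\mathbb{R}^n$ be a convex domain, let $\nu$ be an admissible measure on the space $\mathcal{H}$ of hyperplanes, fix $o\in\Omega$, and let $d_\nu$ and $f_\nu$ be the associated metric and map. If $\nu$ is uniformly transverse on $\Omega$, then $f_\nu$ is a bi-Lipschitz embedding of $(\Omega,d_\nu)$ into $\mathbb{R}^n$ (with the Euclidean metric). Furthermore, if $\Omega=\mathbb{R}^n$, then $f_\nu(\Omega)=\mathbb{R}^n$.
   Context: A domain is a nonempty connected open set. $\mathcal{H}$ denotes the set of all hyperplanes ($(n-1)$-dimensional affine subspaces) in $\mathbb{R}^n$, with its standard topology and Borel structure. For $E\subseteq\mathbb{R}^n$, $\pi E\subseteq\mathcal{H}$ is the set of all hyperplanes that intersect $E$; $[x,y]$ is the closed line segment with endpoints $x,y$. A positive Borel measure $\nu$ on $\mathcal{H}$ is called admissible (for $\Omega$) if: (1) $\nu(\pi E)=0$ when $E$ is a one-point subset of $\Omega$; (2) $\nu(\pi E)>0$ when $E$ is a (nondegenerate) line segment in $\Omega$; (3) $\nu(\pi E)<\infty$ for every compact set $E\subset\Omega$. The associated metric on $\Omega$ is $d_\nu(x,y)=\nu(\pi[x,y])$. For a hyperplane $H$ not passing through $o$, $n(H)$ is the unit normal vector to $H$ pointing out of the halfspace containing $o$. The map $f_\nu\colon\Omega\to\mathbb{R}^n$ is $f_\nu(x)=\int_{\pi[o,x]}n(H)\,d\nu(H)$ (hyperplanes through $o$ form a $\nu$-null set). For a nonzero vector $v$ and $H\in\mathcal{H}$,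 $\alpha(v,H)\in[0,\pi/2]$ is the smaller angle between $H$ and the line determined by $v$ (so $\alpha(v,H)=\pi/2$ when $v$ is orthogonal to $H$). $\nu$ is uniformly transverse on $\Omega$ if there exists $\kappa>0$ such that $\int_{\pi[x,y]}\sin\alpha(x-y,H)\,d\nu(H)\ge\kappa\,\nu(\pi[x,y])$ for all $x,y\in\Omega$ (when $x=y$ both sides are $0$). $F\colon(X,d)\to\mathbb{R}^n$ is a bi-Lipschitz embedding if there is $L\ge1$ with $L^{-1}d(x,y)\le|F(x)-F(y)|\le L\,d(x,y)$ for all $x,y\in X$. *)

theory Defs
  imports "HOL-Analysis.Analysis"
begin

definition hyperplanes :: "'a::euclidean_space set set" where
  "hyperplanes = {H. affine H \<and> aff_dim H = int DIM('a) - 1}"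

lemma hyperplanes_iff:
  "H \<in> hyperplanes \<longleftrightarrow> (\<exists>u b. norm u = 1 \<and> H = {x. u \<bullet> x = b})"
  for H :: "'a::euclidean_space set"
proof
  assume H: "H \<in> hyperplanes"
  then have "affine hull H = H" "aff_dim H = int (DIM('a) - 1)"
    by (simp_all add: hyperplanes_def affine_hull_eq of_nat_diff)
  then have "\<exists>a b. a \<noteq> 0 \<and> H = {x. a \<bullet> x = b}"
    using aff_dim_eq_hyperplane[of H] by (simp only: simp_thms)
  then obtain a b where a: "a \<noteq> 0" and Hab: "H = {x. a \<bullet> x = b}"
    by blast
  have "norm (a /\<^sub>R norm a) = 1"
    using a by simp
  moreover have "H = {x. (a /\<^sub>R norm a) \<bullet> x = b / norm a}"
    using a by (auto simp: Hab divide_simps)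
  ultimately show "\<exists>u b. norm u = 1 \<and> H = {x. u \<bullet> x = b}"
    by blast
next
  assume "\<exists>u b. norm u = 1 \<and> H = {x. u \<bullet> x = b}"
  then obtain u b where u: "norm u = 1" and H: "H = {x. u \<bullet> x = b}"
    by blast
  have "u \<noteq> 0"
    using u by auto
  then show "H \<in> hyperplanes"
    by (simp add: hyperplanes_def H affine_hyperplane aff_dim_hyperplane of_nat_diff)
qed

text \<open>The standard topology: the quotient topology of \<open>S^(n-1) \<times> \<real>\<close> under
  \<open>(u, b) \<mapsto> {x. u \<bullet> x = b}\<close>.\<close>

definition hyperplane_topology :: "'a::euclidean_space set topology" where
  "hyperplane_topology = topology (\<lambda>U. U \<subseteq> hyperplanes \<and>
     openin (top_of_set (sphere 0 1 \<times> (UNIV :: real set)))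
       {(u, b) \<in> sphere 0 1 \<times> UNIV. {x. u \<bullet> x = b} \<in> U})"

lemma openin_hyperplane_topology:
  "openin hyperplane_topology U \<longleftrightarrow> U \<subseteq> hyperplanes \<and>
     openin (top_of_set (sphere 0 1 \<times> (UNIV :: real set)))
       {(u, b) \<in> sphere 0 1 \<times> UNIV. {x. u \<bullet> x = b} \<in> U}"
  for U :: "'a::euclidean_space set set"
proof -
  let ?P = "\<lambda>U :: 'a set set. {(u, b) \<in> sphere 0 1 \<times> (UNIV :: real set). {x. u \<bullet> x = b} \<in> U}"
  have I: "?P (S \<inter> T) = ?P S \<inter> ?P T" for S T
    by auto
  have Un: "?P (\<Union>K) = \<Union>(?P ` K)" for K
    by auto
  have "istopology (\<lambda>U. U \<subseteq> hyperplanes \<and>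
          openin (top_of_set (sphere 0 1 \<times> (UNIV :: real set))) (?P U))"
    unfolding istopology_def I Un by (auto intro!: openin_Int openin_Union)
  then show ?thesis
    by (simp add: hyperplane_topology_def topology_inverse')
qed

lemma topspace_hyperplane_topology: "topspace hyperplane_topology = hyperplanes"
proof -
  have "{(u, b) \<in> sphere 0 1 \<times> (UNIV :: real set). {x. u \<bullet> x = b} \<in> hyperplanes}
      = sphere (0 :: 'a) 1 \<times> UNIV"
    by (auto simp: hyperplanes_iff)
  then have "openin hyperplane_topology (hyperplanes :: 'a set set)"
    by (simp add: openin_hyperplane_topology)
  then show ?thesis
    by (metis openin_hyperplane_topology openin_subset openin_topspace subset_antisym)
qed

definition hyperplane_borel :: "'a::euclidean_space set measure" where
  "hyperplane_borel = sigma hyperplanes {U. openin hyperplane_topology U}"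

lemma sets_hyperplane_borel:
  "sets hyperplane_borel = sigma_sets hyperplanes {U. openin hyperplane_topology U}"
  unfolding hyperplane_borel_def
  by (rule sets_measure_of) (auto simp: openin_hyperplane_topology)

definition hitting :: "'a::euclidean_space set \<Rightarrow> 'a set set" where
  "hitting E = {H \<in> hyperplanes. H \<inter> E \<noteq> {}}"

text \<open>\<^const>\<open>emeasure\<close> is \<open>0\<close> on non-measurable sets; the next fact shows that this convention plays
  no role in the definitions below.\<close>

lemma hitting_compact_measurable:
  fixes E :: "'a::euclidean_space set"
  assumes "compact E"
  shows "hitting E \<in> sets hyperplane_borel"
proof -
  let ?S = "sphere (0 :: 'a) 1 \<times> (UNIV :: real set)"
  let ?C = "(\<lambda>(u, x). (u, u \<bullet> x)) ` (sphere 0 1 \<times> E)"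
  have "compact ?C"
    using assms
    by (intro compact_continuous_image compact_Times)
       (auto simp: case_prod_unfold intro!: continuous_intros)
  then have "closedin (top_of_set ?S) ?C"
    by (intro closed_subset) (auto intro: compact_imp_closed)
  then have "openin (top_of_set ?S) (?S - ?C)"
    by (simp add: closedin_def)
  moreover have "{(u, b) \<in> ?S. {x. u \<bullet> x = b} \<in> hyperplanes - hitting E} = ?S - ?C"
    by (auto simp: hitting_def hyperplanes_iff image_iff)
  ultimately have "openin hyperplane_topology (hyperplanes - hitting E)"
    by (simp add: openin_hyperplane_topology)
  then have "hyperplanes - (hyperplanes - hitting E) \<in> sets hyperplane_borel"
    unfolding sets_hyperplane_borel by (intro sigma_sets.Compl sigma_sets.Basic) simp
  moreover have "hyperplanes - (hyperplanes - hitting E) = hitting E"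
    by (auto simp: hitting_def)
  ultimately show ?thesis
    by simp
qed

definition admissible :: "'a::euclidean_space set \<Rightarrow> 'a set measure \<Rightarrow> bool" where
  "admissible \<Omega> \<nu> \<longleftrightarrow>
     sets \<nu> = sets hyperplane_borel \<and>
     (\<forall>x\<in>\<Omega>. emeasure \<nu> (hitting {x}) = 0) \<and>
     (\<forall>x y. x \<noteq> y \<and> closed_segment x y \<subseteq> \<Omega> \<longrightarrow> emeasure \<nu> (hitting (closed_segment x y)) > 0) \<and>
     (\<forall>E. compact E \<and> E \<subseteq> \<Omega> \<longrightarrow> emeasure \<nu> (hitting E) < \<infinity>)"

definition dist_of :: "'a::euclidean_space set measure \<Rightarrow> 'a \<Rightarrow> 'a \<Rightarrow> real" where
  "dist_of \<nu> x y = measure \<nu> (hitting (closed_segment x y))"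

text \<open>The value \<open>0\<close> for hyperplanes through \<open>p\<close> is a dummy.\<close>

definition outward_normal :: "'a::euclidean_space \<Rightarrow> 'a set \<Rightarrow> 'a" where
  "outward_normal p H =
     (if p \<in> H then 0
      else THE u. norm u = 1 \<and> (\<exists>b. H = {x. u \<bullet> x = b} \<and> p \<in> {x. u \<bullet> x < b}))"

lemma outward_normal_eq:
  assumes u: "norm u = 1" and p: "u \<bullet> p < b"
  shows "outward_normal p {x. u \<bullet> x = b} = u"
proof -
  let ?Q = "\<lambda>w. norm w = 1 \<and> (\<exists>c. {x. u \<bullet> x = b} = {x. w \<bullet> x = c} \<and> p \<in> {x. w \<bullet> x < c})"
  have "w = u" if "?Q w" for w
  proof -
    from that obtain c where w: "norm w = 1" and eq: "{x. u \<bullet> x = b} = {x. w \<bullet> x = c}"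
      and wp: "w \<bullet> p < c"
      by blast
    have uu: "u \<bullet> u = 1" and ww: "w \<bullet> w = 1"
      using u w by (simp_all add: norm_eq_1)
    define t where "t = b - u \<bullet> p"
    have "u \<bullet> (p + t *\<^sub>R u) = b"
      by (simp add: inner_add_right uu t_def)
    then have "w \<bullet> (p + t *\<^sub>R u) = c"
      using eq by blast
    then have pos: "t * (w \<bullet> u) = c - w \<bullet> p"
      by (simp add: inner_add_right)
    \<comment> \<open>moving within the hyperplane by the tangential part of \<open>w\<close>\<close>
    define z where "z = w - (w \<bullet> u) *\<^sub>R u"
    have "u \<bullet> (p + t *\<^sub>R u + z) = b"
      by (simp add: inner_add_right inner_diff_right uu t_def z_def inner_commute)
    then have "w \<bullet> (p + t *\<^sub>R u + z) = c"
      using eq by blast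
    then have "w \<bullet> z = 0"
      using pos by (simp add: inner_add_right)
    then have sq: "(w \<bullet> u)\<^sup>2 = 1"
      by (simp add: z_def inner_diff_right ww power2_eq_square)
    have "t > 0" "t * (w \<bullet> u) > 0"
      using p wp pos by (simp_all add: t_def)
    then have "w \<bullet> u > 0"
      by (simp add: zero_less_mult_iff)
    with sq have "w \<bullet> u = 1"
      by (simp add: power2_eq_1_iff)
    then have "(w - u) \<bullet> (w - u) = 0"
      by (simp add: inner_diff_left inner_diff_right uu ww inner_commute)
    then show "w = u"
      by simp
  qed
  moreover have "?Q u"
    using u p by blast
  ultimately have "(THE w. ?Q w) = u"
    by (rule the_equality[rotated])
  then show ?thesis
    using p by (simp add: outward_normal_def)
qed

definition normal_map :: "'a::euclidean_space set measure \<Rightarrow> 'a \<Rightarrow> 'a \<Rightarrow> 'a" where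
  "normal_map \<nu> p x = (LINT H:hitting (closed_segment p x)|\<nu>. outward_normal p H)"

definition vec_angle :: "'a::euclidean_space \<Rightarrow> 'a \<Rightarrow> real" where
  "vec_angle v w = arccos (v \<bullet> w / (norm v * norm w))"

text \<open>The angle between the line spanned by \<open>v\<close> and a hyperplane is the least angle that \<open>v\<close> makes
  with a nonzero direction of the hyperplane. (Directions come in pairs \<open>\<plusminus>w\<close>, so this lies in
  \<open>[0, \<pi>/2]\<close>; nonzero directions exist when \<open>n \<ge> 2\<close>.)\<close>

definition plane_angle :: "'a::euclidean_space \<Rightarrow> 'a set \<Rightarrow> real" where
  "plane_angle v H = (INF w \<in> {x - y |x y. x \<in> H \<and> y \<in> H} - {0}. vec_angle v w)"

lemma sin_plane_angle:
  fixes u v :: "'a::euclidean_space"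
  assumes dim: "DIM('a) \<ge> 2" and u: "norm u = 1" and v: "v \<noteq> 0"
  shows "sin (plane_angle v {x. u \<bullet> x = b}) = \<bar>u \<bullet> v\<bar> / norm v"
    and "plane_angle v {x. u \<bullet> x = b} \<in> {0..pi/2}"
proof -
  define D where "D = {x - y |x y. x \<in> {x. u \<bullet> x = b} \<and> y \<in> {x. u \<bullet> x = b}} - {0}"
  have uu: "u \<bullet> u = 1"
    using u by (simp add: norm_eq_1)
  have D: "w \<in> D \<longleftrightarrow> w \<noteq> 0 \<and> u \<bullet> w = 0" for w
  proof
    assume w: "w \<noteq> 0 \<and> u \<bullet> w = 0"
    moreover have "w = (b *\<^sub>R u + w) - b *\<^sub>R u"
      by simp
    moreover have "u \<bullet> (b *\<^sub>R u + w) = b" "u \<bullet> (b *\<^sub>R u) = b"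
      using w by (simp_all add: inner_add_right uu)
    ultimately have "\<exists>x y. w = x - y \<and> u \<bullet> x = b \<and> u \<bullet> y = b"
      by metis
    with w show "w \<in> D"
      by (simp add: D_def)
  qed (auto simp: D_def inner_diff_right)
  define z where "z = v - (u \<bullet> v) *\<^sub>R u"
  define s where "s = norm z / norm v"
  have vw: "v \<bullet> w = z \<bullet> w" if "w \<in> D" for w
    using that by (simp add: D z_def inner_diff_left)
  have uz: "u \<bullet> z = 0"
    by (simp add: z_def inner_diff_right uu)
  have "v \<bullet> v = z \<bullet> z + (u \<bullet> v)\<^sup>2"
    by (simp add: z_def inner_diff_left inner_diff_right uu inner_commute power2_eq_square)
  then have nz: "(norm z)\<^sup>2 = (norm v)\<^sup>2 - (u \<bullet> v)\<^sup>2"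
    by (simp add: power2_norm_eq_inner)
  then have "(norm z)\<^sup>2 \<le> (norm v)\<^sup>2"
    by simp
  then have "norm z \<le> norm v"
    by (rule power2_le_imp_le) simp
  then have s: "0 \<le> s" "s \<le> 1"
    using v by (simp_all add: s_def)
  have le: "arccos s \<le> vec_angle v w" if w: "w \<in> D" for w
  proof -
    have "norm v * norm w > 0"
      using v w by (simp add: D)
    moreover have "\<bar>v \<bullet> w\<bar> \<le> norm v * norm w"
      by (rule Cauchy_Schwarz_ineq2)
    ultimately have "-1 \<le> v \<bullet> w / (norm v * norm w)"
      by (simp add: field_simps abs_le_iff)
    moreover have "v \<bullet> w \<le> norm z * norm w"
      unfolding vw[OF w] by (rule norm_cauchy_schwarz)
    then have "v \<bullet> w / (norm v * norm w) \<le> norm z * norm w / (norm v * norm w)"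
      by (intro divide_right_mono) auto
    then have "v \<bullet> w / (norm v * norm w) \<le> s"
      using w by (simp add: D s_def)
    ultimately show ?thesis
      unfolding vec_angle_def using s by (intro arccos_le_arccos) auto
  qed
  have "\<exists>w\<in>D. vec_angle v w = arccos s"
  proof (cases "z = 0")
    case True
    obtain w where "w \<noteq> 0" "orthogonal u w"
      using orthogonal_to_vector_exists[OF dim] by blast
    then have "w \<in> D"
      by (simp add: D orthogonal_def)
    with True show ?thesis
      by (intro bexI[of _ w]) (simp_all add: vec_angle_def vw s_def)
  next
    case False
    then have z: "z \<in> D"
      by (simp add: D uz)
    have "v \<bullet> z = norm z * norm z"
      by (simp add: vw[OF z] flip: power2_norm_eq_inner power2_eq_square)
    with False z show ?thesis
      by (intro bexI[of _ z]) (simp_all add: vec_angle_def s_def)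
  qed
  then have "arccos s \<in> vec_angle v ` D"
    by force
  then have "Inf (vec_angle v ` D) = arccos s"
    using le by (intro cInf_eq_minimum) auto
  then have angle: "plane_angle v {x. u \<bullet> x = b} = arccos s"
    by (simp add: plane_angle_def D_def)
  have "1 - s\<^sup>2 = (\<bar>u \<bullet> v\<bar> / norm v)\<^sup>2"
    using v by (simp add: s_def power_divide nz diff_divide_distrib)
  then have "sqrt (1 - s\<^sup>2) = \<bar>u \<bullet> v\<bar> / norm v"
    by (simp only: real_sqrt_abs) simp
  then show "sin (plane_angle v {x. u \<bullet> x = b}) = \<bar>u \<bullet> v\<bar> / norm v"
    using s by (simp add: angle sin_arccos)
  show "plane_angle v {x. u \<bullet> x = b} \<in> {0..pi/2}"
    using s arccos_le_pi2[of s] arccos_lbound[of s] by (simp add: angle)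
qed

definition uniformly_transverse :: "'a::euclidean_space set \<Rightarrow> 'a set measure \<Rightarrow> bool" where
  "uniformly_transverse \<Omega> \<nu> \<longleftrightarrow>
     (\<exists>\<kappa>>0. \<forall>x\<in>\<Omega>. \<forall>y\<in>\<Omega>.
        (LINT H:hitting (closed_segment x y)|\<nu>. sin (plane_angle (x - y) H))
          \<ge> \<kappa> * measure \<nu> (hitting (closed_segment x y)))"

definition bilipschitz_embedding ::
    "'a set \<Rightarrow> ('a \<Rightarrow> 'a \<Rightarrow> real) \<Rightarrow> ('a \<Rightarrow> 'b::metric_space) \<Rightarrow> bool" where
  "bilipschitz_embedding X d F \<longleftrightarrow>
     (\<exists>L\<ge>1. \<forall>x\<in>X. \<forall>y\<in>X. inverse L * d x y \<le> dist (F x) (F y) \<and> dist (F x) (F y) \<le> L * d x y)"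

end

theory Submission
  imports Defs
begin

text \<open>The difference \<open>f x - f y\<close> is the integral, over the hyperplanes separating \<open>x\<close> from \<open>y\<close>,
  of the normal pointing towards \<open>x\<close>. Hence \<open>|f x - f y| \<le> d(x, y)\<close>, and the component of
  \<open>f x - f y\<close> along \<open>x - y\<close> is the integral of \<open>sin \<alpha>\<close>, which is at least \<open>\<kappa> d(x, y)\<close> by
  transversality. So \<open>f\<close> is bi-Lipschitz and \<open>(f x - f y) \<bullet> (x - y) \<ge> \<kappa> |f x - f y| |x - y|\<close>.
  A continuous injective map with the latter property on the whole space has open range by
  invariance of domain, and in dimension at least two its range is also closed.\<close>

section \<open>Hyperplanes and segments\<close>

text \<open>A unit normal is determined only up to sign, and \<open>(u, b)\<close> may be replaced
  by \<open>(- u, - b)\<close>.\<close>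

lemma hyperplane_cases_side:
  assumes "H \<in> hyperplanes" "q \<notin> H"
  obtains u b where "norm u = 1" "H = {x. u \<bullet> x = b}" "u \<bullet> q < b"
proof -
  obtain u b where u: "norm u = 1" "H = {x. u \<bullet> x = b}"
    using assms(1) by (auto simp: hyperplanes_iff)
  show ?thesis
  proof (cases "u \<bullet> q < b")
    case True
    then show ?thesis
      using u that by blast
  next
    case False
    moreover have "H = {x. (- u) \<bullet> x = - b}"
      using u by simp
    ultimately show ?thesis
      using u assms(2) by (intro that[of "- u" "- b"]) auto
  qed
qed

text \<open>The functional \<open>(\<bullet>) u\<close> maps the segment onto the real interval
  between its values at the endpoints.\<close>

lemma hyperplane_Int_segment_iff:
  fixes u :: "'a::real_inner"
  shows "{z. u \<bullet> z = b} \<inter> closed_segment x y \<noteq> {} \<longleftrightarrow>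
    u \<bullet> x \<le> b \<and> b \<le> u \<bullet> y \<or> u \<bullet> y \<le> b \<and> b \<le> u \<bullet> x"
proof -
  have "{z. u \<bullet> z = b} \<inter> closed_segment x y \<noteq> {} \<longleftrightarrow> b \<in> (\<bullet>) u ` closed_segment x y"
    by auto
  also have "(\<bullet>) u ` closed_segment x y = closed_segment (u \<bullet> x) (u \<bullet> y)"
    by (rule closed_segment_linear_image[symmetric])
      (simp add: bounded_linear.linear bounded_linear_inner_right)
  finally show ?thesis
    by (auto simp: closed_segment_eq_real_ivl)
qed

text \<open>By Cauchy-Schwarz every point of the plane has distance at least
  \<open>\<bar>b - u \<bullet> q\<bar>\<close> from \<open>q\<close>, and the given point attains
  it. Its continuity in \<open>(u, b)\<close> is the source of measurability below.\<close>

lemma closest_point_hyperplane: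
  fixes u :: "'a::euclidean_space"
  assumes "norm u = 1"
  shows "closest_point {x. u \<bullet> x = b} q = q + (b - u \<bullet> q) *\<^sub>R u"
proof -
  have uu: "u \<bullet> u = 1"
    using assms by (simp add: norm_eq_1)
  let ?z = "q + (b - u \<bullet> q) *\<^sub>R u"
  have "?z = closest_point {x. u \<bullet> x = b} q"
  proof (rule closest_point_unique)
    show "\<forall>z\<in>{x. u \<bullet> x = b}. dist q ?z \<le> dist q z"
    proof
      fix z assume "z \<in> {x. u \<bullet> x = b}"
      then have "\<bar>b - u \<bullet> q\<bar> = \<bar>u \<bullet> (z - q)\<bar>"
        by (simp add: inner_diff_right)
      also have "\<dots> \<le> norm u * norm (z - q)"
        by (rule Cauchy_Schwarz_ineq2)
      finally show "dist q ?z \<le> dist q z"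
        using assms by (simp add: dist_norm norm_minus_commute)
    qed
  qed (auto simp: convex_hyperplane closed_hyperplane inner_add_right uu)
  then show ?thesis ..
qed

text \<open>Replaces the definite description by a formula fit for measurability;
  \<open>sgn 0 = 0\<close> matches the dummy value for planes through \<open>q\<close>.\<close>

lemma outward_normal_eq_sgn:
  assumes "H \<in> hyperplanes"
  shows "outward_normal q H = sgn (closest_point H q - q)"
proof (cases "q \<in> H")
  case True
  then show ?thesis
    by (simp add: outward_normal_def closest_point_self)
next
  case False
  then obtain u b where "norm u = 1" "H = {x. u \<bullet> x = b}" "u \<bullet> q < b"
    using assms hyperplane_cases_side by blast
  then show ?thesis
    by (simp add: outward_normal_eq closest_point_hyperplane sgn_div_norm)
qed

lemma norm_outward_normal_le:
  assumes "H \<in> hyperplanes"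
  shows "norm (outward_normal q H) \<le> 1"
  by (simp add: outward_normal_eq_sgn[OF assms] norm_sgn)

text \<open>Both sides count the hyperplanes separating \<open>x\<close> from \<open>y\<close>, with the normal oriented
  towards \<open>x\<close>; those separating \<open>q\<close> from both points cancel.\<close>

lemma outward_normal_change_base:
  fixes H :: "'a::euclidean_space set"
  assumes "H \<in> hyperplanes" "q \<notin> H" "x \<notin> H" "y \<notin> H"
  shows "indicator (hitting (closed_segment q x)) H *\<^sub>R outward_normal q H
      - indicator (hitting (closed_segment q y)) H *\<^sub>R outward_normal q H
    = indicator (hitting (closed_segment x y)) H *\<^sub>R outward_normal y H"
proof -
  obtain u b where u: "norm u = 1" and H: "H = {x. u \<bullet> x = b}" and q: "u \<bullet> q < b"
    using assms hyperplane_cases_side by blast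
  have hit: "H \<in> hitting (closed_segment v w) \<longleftrightarrow>
      u \<bullet> v \<le> b \<and> b \<le> u \<bullet> w \<or> u \<bullet> w \<le> b \<and> b \<le> u \<bullet> v" for v w
    using assms(1) hyperplane_Int_segment_iff[of u b v w] by (simp add: hitting_def H)
  have nq: "outward_normal q H = u"
    using outward_normal_eq[OF u q] H by simp
  have xy: "u \<bullet> x \<noteq> b" "u \<bullet> y \<noteq> b"
    using assms H by auto
  show ?thesis
  proof (cases "u \<bullet> y < b")
    case True
    then have "outward_normal y H = u"
      using outward_normal_eq[OF u] H by simp
    then show ?thesis
      using True xy q by (auto simp: indicator_def hit nq)
  next
    case False
    then have "outward_normal y {x. (- u) \<bullet> x = - b} = - u"
      using xy u by (intro outward_normal_eq) auto
    then have "outward_normal y H = - u"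
      by (simp add: H)
    then show ?thesis
      using False xy q by (auto simp: indicator_def hit nq)
  qed
qed

text \<open>Since \<open>x\<close> does not lie on the side of \<open>y\<close>, the normal pointing
  away from \<open>y\<close> has nonnegative product with \<open>x - y\<close>, so the absolute
  value in the sine formula disappears.\<close>

lemma outward_normal_inner_eq_sin:
  fixes H :: "'a::euclidean_space set"
  assumes "DIM('a) \<ge> 2" "H \<in> hitting (closed_segment x y)" "y \<notin> H"
  shows "outward_normal y H \<bullet> (x - y) = norm (x - y) * sin (plane_angle (x - y) H)"
proof (cases "x = y")
  case False
  have "H \<in> hyperplanes"
    using assms by (simp add: hitting_def)
  then obtain u b where u: "norm u = 1" and H: "H = {x. u \<bullet> x = b}" and y: "u \<bullet> y < b"
    using assms hyperplane_cases_side by blast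
  have "u \<bullet> x \<ge> b"
    using assms(2) y hyperplane_Int_segment_iff[of u b x y] by (auto simp: hitting_def H)
  then have "\<bar>u \<bullet> (x - y)\<bar> = u \<bullet> (x - y)"
    using y by (simp add: inner_diff_right)
  then show ?thesis
    using sin_plane_angle(1)[OF assms(1) u, of "x - y" b] outward_normal_eq[OF u y] False
    by (simp add: H)
qed simp

section \<open>Measurability\<close>

lemma space_hyperplane_borel: "space hyperplane_borel = hyperplanes"
  unfolding hyperplane_borel_def
  by (rule space_measure_of) (auto simp: openin_hyperplane_topology)

text \<open>The hyperplanes carry a quotient topology, so continuity can be tested on the pairs
  \<open>(u, b)\<close>; preimages of open sets are then open and hence Borel.\<close>

lemma borel_measurable_hyperplane_borelI:
  fixes h :: "'a::euclidean_space set \<Rightarrow> 'b::topological_space"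
  assumes "continuous_on (sphere 0 1 \<times> (UNIV :: real set)) (\<lambda>(u, b). h {x. u \<bullet> x = b})"
  shows "h \<in> borel_measurable hyperplane_borel"
proof (rule borel_measurableI)
  fix S :: "'b set" assume "open S"
  let ?S = "sphere (0 :: 'a) 1 \<times> (UNIV :: real set)"
  have "openin (top_of_set ?S) (?S \<inter> (\<lambda>(u, b). h {x. u \<bullet> x = b}) -` S)"
    using continuous_openin_preimage_gen[OF assms \<open>open S\<close>] .
  moreover have "?S \<inter> (\<lambda>(u, b). h {x. u \<bullet> x = b}) -` S
      = {(u, b) \<in> ?S. {x. u \<bullet> x = b} \<in> h -` S \<inter> hyperplanes}"
    by (auto simp: hyperplanes_iff)
  ultimately have "openin hyperplane_topology (h -` S \<inter> hyperplanes)"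
    by (simp add: openin_hyperplane_topology)
  then show "h -` S \<inter> space hyperplane_borel \<in> sets hyperplane_borel"
    unfolding sets_hyperplane_borel space_hyperplane_borel by (intro sigma_sets.Basic) simp
qed

lemma continuous_on_sphere_cong:
  assumes "continuous_on (sphere 0 1 \<times> UNIV) g"
    and "\<And>u b. norm u = 1 \<Longrightarrow> h u b = g (u, b)"
  shows "continuous_on (sphere 0 1 \<times> UNIV) (\<lambda>(u, b). h u b)"
  by (rule continuous_on_eq[OF assms(1)]) (auto simp: assms(2))

text \<open>The normal jumps at planes through \<open>q\<close>, but the displacement from
  \<open>q\<close> to its projection is continuous in the plane, and \<open>sgn\<close> is a Borel
  map.\<close>

lemma outward_normal_measurable:
  "outward_normal (q :: 'a::euclidean_space) \<in> borel_measurable hyperplane_borel"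
proof -
  have "(\<lambda>H. closest_point H q - q) \<in> borel_measurable hyperplane_borel"
    by (intro borel_measurable_hyperplane_borelI
        continuous_on_sphere_cong[where g = "\<lambda>w. (snd w - fst w \<bullet> q) *\<^sub>R fst w"])
      (auto simp: closest_point_hyperplane intro!: continuous_intros)
  then have "(\<lambda>H. sgn (closest_point H q - q)) \<in> borel_measurable hyperplane_borel"
    unfolding sgn_div_norm by measurable
  then show ?thesis
    by (rule measurable_cong[THEN iffD1, rotated])
      (simp add: outward_normal_eq_sgn space_hyperplane_borel)
qed

lemma sin_plane_angle_measurable:
  fixes v :: "'a::euclidean_space"
  assumes "DIM('a) \<ge> 2" "v \<noteq> 0"
  shows "(\<lambda>H. sin (plane_angle v H)) \<in> borel_measurable hyperplane_borel"
  by (intro borel_measurable_hyperplane_borelI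
      continuous_on_sphere_cong[where g = "\<lambda>w. \<bar>fst w \<bullet> v\<bar> / norm v"])
    (use assms in \<open>auto simp: sin_plane_angle(1) intro!: continuous_intros\<close>)

section \<open>The map of an admissible measure\<close>

context
  fixes \<Omega> :: "'a::euclidean_space set" and \<nu> :: "'a set measure"
  assumes convex: "convex \<Omega>" and adm: "admissible \<Omega> \<nu>"
begin

section \<open>Measurable sets and null sets of an admissible measure\<close>

lemma sets_admissible: "sets \<nu> = sets hyperplane_borel"
  using adm by (simp add: admissible_def)

lemma space_admissible: "space \<nu> = hyperplanes"
  using sets_eq_imp_space_eq[OF sets_admissible] by (simp add: space_hyperplane_borel)

lemma measurable_admissible: "borel_measurable \<nu> = borel_measurable hyperplane_borel"
  using sets_admissible by (intro measurable_cong_sets) auto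

lemma hitting_admissible_measurable: "compact E \<Longrightarrow> hitting E \<in> sets \<nu>"
  by (simp add: sets_admissible hitting_compact_measurable)

lemma hitting_admissible_finite: "compact E \<Longrightarrow> E \<subseteq> \<Omega> \<Longrightarrow> emeasure \<nu> (hitting E) < top"
  using adm by (simp add: admissible_def)

lemma AE_not_in_hyperplane:
  assumes "x \<in> \<Omega>"
  shows "AE H in \<nu>. x \<notin> H"
proof (rule AE_I')
  show "hitting {x} \<in> null_sets \<nu>"
    using adm assms hitting_admissible_measurable[of "{x}"] by (simp add: admissible_def null_sets_def)
  show "{H \<in> space \<nu>. \<not> x \<notin> H} \<subseteq> hitting {x}"
    by (auto simp: space_admissible hitting_def)
qed

lemma segment_in_domain: "x \<in> \<Omega> \<Longrightarrow> y \<in> \<Omega> \<Longrightarrow> closed_segment x y \<subseteq> \<Omega>"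
  by (rule closed_segment_subset[OF _ _ convex])

section \<open>Differences of values of the map\<close>

lemma outward_normal_set_integrable:
  assumes "x \<in> \<Omega>" "y \<in> \<Omega>"
  shows "set_integrable \<nu> (hitting (closed_segment x y)) (outward_normal q)"
  unfolding set_integrable_def
proof (rule integrableI_bounded_set_indicator)
  show "outward_normal q \<in> borel_measurable \<nu>"
    by (simp add: measurable_admissible outward_normal_measurable)
  show "AE H in \<nu>. H \<in> hitting (closed_segment x y) \<longrightarrow> norm (outward_normal q H) \<le> 1"
    by (intro AE_I2) (simp add: space_admissible norm_outward_normal_le)
qed (use assms in \<open>simp_all add: hitting_admissible_measurable hitting_admissible_finite
      segment_in_domain\<close>)

text \<open>Planes through \<open>q\<close>, \<open>x\<close> or \<open>y\<close> form a null set,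
  and for all others the change of base point holds pointwise.\<close>

lemma normal_map_diff:
  assumes "q \<in> \<Omega>" "x \<in> \<Omega>" "y \<in> \<Omega>"
  shows "normal_map \<nu> q x - normal_map \<nu> q y
    = (LINT H:hitting (closed_segment x y)|\<nu>. outward_normal y H)"
proof -
  note int = outward_normal_set_integrable[unfolded set_integrable_def]
  have "normal_map \<nu> q x - normal_map \<nu> q y
      = (LINT H|\<nu>. indicator (hitting (closed_segment q x)) H *\<^sub>R outward_normal q H
          - indicator (hitting (closed_segment q y)) H *\<^sub>R outward_normal q H)"
    unfolding normal_map_def set_lebesgue_integral_def
    by (rule Bochner_Integration.integral_diff[symmetric]) (intro int assms)+
  also have "\<dots> = (LINT H|\<nu>. indicator (hitting (closed_segment x y)) H *\<^sub>R outward_normal y H)"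
  proof (rule integral_cong_AE)
    show "AE H in \<nu>. indicator (hitting (closed_segment q x)) H *\<^sub>R outward_normal q H
          - indicator (hitting (closed_segment q y)) H *\<^sub>R outward_normal q H
        = indicator (hitting (closed_segment x y)) H *\<^sub>R outward_normal y H"
      using AE_not_in_hyperplane[OF assms(1)] AE_not_in_hyperplane[OF assms(2)]
        AE_not_in_hyperplane[OF assms(3)] AE_space
    proof eventually_elim
      case (elim H)
      then show ?case
        by (intro outward_normal_change_base) (auto simp: space_admissible)
    qed
  qed (intro borel_measurable_diff borel_measurable_integrable int assms)+
  finally show ?thesis
    by (simp add: set_lebesgue_integral_def)
qed

lemma dist_normal_map_le:
  assumes "q \<in> \<Omega>" "x \<in> \<Omega>" "y \<in> \<Omega>"
  shows "dist (normal_map \<nu> q x) (normal_map \<nu> q y) \<le> dist_of \<nu> x y"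
proof -
  let ?A = "hitting (closed_segment x y)"
  have A: "?A \<in> sets \<nu>" "emeasure \<nu> ?A < top"
    using assms
    by (simp_all add: hitting_admissible_measurable hitting_admissible_finite segment_in_domain)
  have "dist (normal_map \<nu> q x) (normal_map \<nu> q y)
      = norm (LINT H|\<nu>. indicator ?A H *\<^sub>R outward_normal y H)"
    by (simp add: dist_norm normal_map_diff[OF assms] set_lebesgue_integral_def)
  also have "\<dots> \<le> (LINT H|\<nu>. norm (indicator ?A H *\<^sub>R outward_normal y H))"
    by (rule integral_norm_bound)
  also have "\<dots> \<le> (LINT H|\<nu>. indicator ?A H)"
  proof (rule integral_mono)
    show "integrable \<nu> (\<lambda>H. norm (indicator ?A H *\<^sub>R outward_normal y H))"
      using outward_normal_set_integrable assms by (intro integrable_norm) (simp add: set_integrable_def)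
    show "integrable \<nu> (indicator ?A :: _ \<Rightarrow> real)"
      using A by (intro integrable_real_indicator) auto
    show "norm (indicator ?A H *\<^sub>R outward_normal y H) \<le> indicator ?A H" if "H \<in> space \<nu>" for H
      using that by (simp add: indicator_def space_admissible norm_outward_normal_le)
  qed
  also have "\<dots> = dist_of \<nu> x y"
    using A by (simp add: dist_of_def)
  finally show ?thesis .
qed

text \<open>The product with the fixed vector \<open>x - y\<close> passes under the integral, where
  it becomes the sine. The case \<open>x = y\<close> is separate because the sine formula requires a
  nonzero vector.\<close>

lemma inner_normal_map_diff:
  assumes "DIM('a) \<ge> 2" "q \<in> \<Omega>" "x \<in> \<Omega>" "y \<in> \<Omega>"
  shows "(normal_map \<nu> q x - normal_map \<nu> q y) \<bullet> (x - y)
    = norm (x - y) * (LINT H:hitting (closed_segment x y)|\<nu>. sin (plane_angle (x - y) H))"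
proof (cases "x = y")
  case False
  let ?A = "hitting (closed_segment x y)"
  have int: "integrable \<nu> (\<lambda>H. indicator ?A H *\<^sub>R outward_normal y H)"
    using outward_normal_set_integrable assms by (simp add: set_integrable_def)
  have A: "?A \<in> sets \<nu>"
    by (simp add: hitting_admissible_measurable)
  have [measurable]: "(\<lambda>H. sin (plane_angle (x - y) H)) \<in> borel_measurable \<nu>"
    using sin_plane_angle_measurable[of "x - y"] assms(1) False by (simp add: measurable_admissible)
  have "(normal_map \<nu> q x - normal_map \<nu> q y) \<bullet> (x - y)
      = (LINT H|\<nu>. indicator ?A H *\<^sub>R outward_normal y H) \<bullet> (x - y)"
    by (simp add: normal_map_diff[OF assms(2-)] set_lebesgue_integral_def)
  also have "\<dots> = (LINT H|\<nu>. (indicator ?A H *\<^sub>R outward_normal y H) \<bullet> (x - y))"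
    by (rule integral_inner_left[symmetric]) (rule int)
  also have "\<dots> = (LINT H|\<nu>. norm (x - y) * (indicator ?A H *\<^sub>R sin (plane_angle (x - y) H)))"
  proof (rule integral_cong_AE)
    show "(\<lambda>H. (indicator ?A H *\<^sub>R outward_normal y H) \<bullet> (x - y)) \<in> borel_measurable \<nu>"
      by (intro borel_measurable_inner borel_measurable_integrable[OF int]) simp
    show "(\<lambda>H. norm (x - y) * (indicator ?A H *\<^sub>R sin (plane_angle (x - y) H))) \<in> borel_measurable \<nu>"
      using A by measurable
    show "AE H in \<nu>. (indicator ?A H *\<^sub>R outward_normal y H) \<bullet> (x - y)
        = norm (x - y) * (indicator ?A H *\<^sub>R sin (plane_angle (x - y) H))"
      using AE_not_in_hyperplane[OF assms(4)]
      by eventually_elim (simp add: indicator_def outward_normal_inner_eq_sin[OF assms(1)])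
  qed
  finally show ?thesis
    by (simp add: set_lebesgue_integral_def)
qed simp

section \<open>Positivity of the metric and continuity of the map\<close>

lemma dist_of_pos:
  assumes "x \<in> \<Omega>" "y \<in> \<Omega>" "x \<noteq> y"
  shows "dist_of \<nu> x y > 0"
proof -
  have seg: "closed_segment x y \<subseteq> \<Omega>"
    using assms by (simp add: segment_in_domain)
  then have "emeasure \<nu> (hitting (closed_segment x y)) > 0"
    using adm assms by (simp add: admissible_def)
  \<comment> \<open>Finiteness matters here: \<open>measure\<close> sends an infinite value to
    0.\<close>
  with hitting_admissible_finite[OF _ seg] show ?thesis
    unfolding dist_of_def measure_def by (simp add: enn2real_positive_iff)
qed

text \<open>The planes meeting shrinking closed balls around \<open>x\<close> decrease to the null
  set of planes through \<open>x\<close>. Compactness of the balls gives the finite measure required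
  for continuity from above.\<close>

lemma tendsto_dist_of_0:
  assumes "open \<Omega>" "x \<in> \<Omega>"
  shows "((\<lambda>y. dist_of \<nu> y x) \<longlongrightarrow> 0) (at x)"
proof -
  obtain r where r: "r > 0" "cball x r \<subseteq> \<Omega>"
    using assms open_contains_cball by blast
  \<comment> \<open>\<open>Suc n\<close> keeps the radius positive and at most \<open>r\<close>, so
    that all balls stay in \<Omega>.\<close>
  define B where "B n = hitting (cball x (r / real (Suc n)))" for n
  have cball_sub: "cball x (r / real (Suc n)) \<subseteq> \<Omega>" for n
    using r by (intro order_trans[OF _ r(2)] subset_cball) (simp add: field_simps)
  have "(\<lambda>n. measure \<nu> (B n)) \<longlonglongrightarrow> measure \<nu> (\<Inter>n. B n)"
  proof (rule Lim_measure_decseq)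
    show "range B \<subseteq> sets \<nu>"
      by (auto simp: B_def hitting_admissible_measurable)
    show "decseq B"
      unfolding decseq_def B_def hitting_def
    proof (intro allI impI)
      fix m n :: nat assume "m \<le> n"
      then have "cball x (r / real (Suc n)) \<subseteq> cball x (r / real (Suc m))"
        using r by (intro subset_cball divide_left_mono) auto
      then show "{H \<in> hyperplanes. H \<inter> cball x (r / real (Suc n)) \<noteq> {}}
          \<subseteq> {H \<in> hyperplanes. H \<inter> cball x (r / real (Suc m)) \<noteq> {}}"
        by blast
    qed
    show "emeasure \<nu> (B n) \<noteq> \<infinity>" for n
      using hitting_admissible_finite[OF _ cball_sub[of n]] by (simp add: B_def)
  qed
  moreover have "(\<Inter>n. B n) = hitting {x}"
  proof (intro equalityI subsetI)
    fix H assume H: "H \<in> (\<Inter>n. B n)"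
    then have hyp: "H \<in> hyperplanes"
      by (auto simp: B_def hitting_def)
    then have "closed H"
      by (auto simp: hyperplanes_iff closed_hyperplane)
    moreover have "x \<in> closure H"
    proof (unfold closure_approachable, intro allI impI)
      fix e :: real assume "e > 0"
      obtain n where "r / e < real n"
        using reals_Archimedean2 by blast
      then have "r / real (Suc n) < e"
        using \<open>e > 0\<close> r by (simp add: field_simps)
      moreover have "H \<in> B n"
        using H by blast
      then obtain z where "z \<in> H" "dist x z \<le> r / real (Suc n)"
        by (auto simp: B_def hitting_def)
      ultimately show "\<exists>z\<in>H. dist z x < e"
        by (intro bexI[of _ z]) (auto simp: dist_commute)
    qed
    ultimately show "H \<in> hitting {x}"
      using hyp by (simp add: hitting_def)
  next
    fix H assume "H \<in> hitting {x}"
    moreover have "x \<in> cball x (r / real (Suc n))" for n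
      using r by simp
    ultimately show "H \<in> (\<Inter>n. B n)"
      unfolding B_def hitting_def by blast
  qed
  moreover have "measure \<nu> (hitting {x}) = 0"
    using adm assms by (simp add: admissible_def measure_def)
  ultimately have lim: "(\<lambda>n. measure \<nu> (B n)) \<longlonglongrightarrow> 0"
    by simp
  show ?thesis
  proof (rule tendstoI)
    fix e :: real assume "e > 0"
    obtain n where n: "measure \<nu> (B n) < e"
      using order_tendstoD(2)[OF lim \<open>e > 0\<close>] by (auto simp: eventually_sequentially)
    have "dist_of \<nu> y x < e" if "dist y x < r / real (Suc n)" for y
    proof -
      have "closed_segment y x \<subseteq> cball x (r / real (Suc n))"
        using that r by (intro closed_segment_subset) (auto simp: dist_commute)
      then have "hitting (closed_segment y x) \<subseteq> B n"
        by (auto simp: B_def hitting_def)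
      then have "measure \<nu> (hitting (closed_segment y x)) \<le> measure \<nu> (B n)"
        using hitting_admissible_finite[OF _ cball_sub[of n]]
        by (intro measure_mono_fmeasurable)
          (auto simp: B_def hitting_admissible_measurable fmeasurable_def)
      then show ?thesis
        using n by (simp add: dist_of_def)
    qed
    moreover have "r / real (Suc n) > 0"
      using r by simp
    moreover have "dist_of \<nu> y x \<ge> 0" for y
      by (simp add: dist_of_def)
    ultimately show "\<forall>\<^sub>F y in at x. dist (dist_of \<nu> y x) 0 < e"
      unfolding eventually_at by (metis abs_of_nonneg dist_real_def diff_zero)
  qed
qed

lemma continuous_on_normal_map:
  assumes "open \<Omega>" "q \<in> \<Omega>"
  shows "continuous_on \<Omega> (normal_map \<nu> q)"
proof (rule continuous_at_imp_continuous_on, rule ballI)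
  fix x assume x: "x \<in> \<Omega>"
  have "\<forall>\<^sub>F y in at x. y \<in> \<Omega>"
    using assms x by (metis eventually_at_topological)
  then have "\<forall>\<^sub>F y in at x. dist (normal_map \<nu> q y) (normal_map \<nu> q x) \<le> dist_of \<nu> y x"
    by eventually_elim (rule dist_normal_map_le[OF assms(2) _ x])
  then have "((\<lambda>y. dist (normal_map \<nu> q y) (normal_map \<nu> q x)) \<longlongrightarrow> 0) (at x)"
    by (intro tendsto_sandwich[OF _ _ tendsto_const tendsto_dist_of_0[OF assms(1) x]]) auto
  then show "isCont (normal_map \<nu> q) x"
    by (simp add: isCont_def tendsto_dist_iff[symmetric])
qed

end

section \<open>Surjectivity of strongly monotone maps\<close>

text \<open>Divide the monotonicity inequality by \<open>norm (X k)\<close>: as \<open>X k\<close>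
  escapes to infinity, \<open>y\<close> drops out of \<open>(X k - y) / norm (X k)\<close>, which
  tends to \<open>w\<close>.\<close>

lemma cone_condition_at_infinity:
  fixes f :: "'a::euclidean_space \<Rightarrow> 'a"
  assumes mono: "\<And>x y. (f x - f y) \<bullet> (x - y) \<ge> \<kappa> * norm (f x - f y) * norm (x - y)"
    and inf: "filterlim (\<lambda>k. norm (X k)) at_top sequentially"
    and dir: "(\<lambda>k. sgn (X k)) \<longlonglongrightarrow> w" and "norm w = 1"
    and lim: "(\<lambda>k. f (X k)) \<longlonglongrightarrow> q"
  shows "(q - f y) \<bullet> w \<ge> \<kappa> * norm (q - f y)"
proof -
  define V where "V k = inverse (norm (X k)) *\<^sub>R (X k - y)" for k
  have "V = (\<lambda>k. sgn (X k) - inverse (norm (X k)) *\<^sub>R y)"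
    by (simp add: V_def sgn_div_norm scaleR_diff_right fun_eq_iff)
  moreover have "(\<lambda>k. inverse (norm (X k))) \<longlonglongrightarrow> 0"
    using inf by (rule tendsto_inverse_0_at_top)
  then have "(\<lambda>k. sgn (X k) - inverse (norm (X k)) *\<^sub>R y) \<longlonglongrightarrow> w - 0 *\<^sub>R y"
    by (intro tendsto_intros dir)
  ultimately have V: "V \<longlonglongrightarrow> w"
    by simp
  have "(f (X k) - f y) \<bullet> V k \<ge> \<kappa> * norm (f (X k) - f y) * norm (V k)" for k
    using mult_left_mono[OF mono[where x = "X k" and y = y], of "inverse (norm (X k))"]
    by (simp add: V_def mult.assoc mult.left_commute del: scaleR_right_diff_distrib)
  moreover have "(\<lambda>k. (f (X k) - f y) \<bullet> V k) \<longlonglongrightarrow> (q - f y) \<bullet> w"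
    by (intro tendsto_intros lim V)
  moreover have "(\<lambda>k. \<kappa> * norm (f (X k) - f y) * norm (V k)) \<longlonglongrightarrow> \<kappa> * norm (q - f y) * norm w"
    by (intro tendsto_intros lim V)
  ultimately have "(q - f y) \<bullet> w \<ge> \<kappa> * norm (q - f y) * norm w"
    by (intro LIMSEQ_le) blast+
  then show ?thesis
    using \<open>norm w = 1\<close> by simp
qed

text \<open>If the range misses a limit point \<open>q\<close>, then it lies in a convex cone with apex \<open>q\<close> around
  \<open>-v\<close> for some unit vector \<open>v\<close>. The set of such \<open>v\<close> is clopen in the sphere, so it contains a pair
  of antipodal vectors, whose cones intersect only in \<open>q\<close>.\<close>

theorem strongly_monotone_surj:
  fixes f :: "'a::euclidean_space \<Rightarrow> 'a"
  assumes dim: "DIM('a) \<ge> 2" and "\<kappa> > 0"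
    and cont: "continuous_on UNIV f" and inj: "inj f"
    and mono: "\<And>x y. (f x - f y) \<bullet> (x - y) \<ge> \<kappa> * norm (f x - f y) * norm (x - y)"
  shows "surj f"
proof -
  have "open (range f)"
    using cont inj by (intro invariance_of_domain) auto
  moreover have "closed (range f)"
  proof (rule ccontr)
    assume "\<not> closed (range f)"
    then obtain q where q: "q \<in> closure (range f)" "q \<notin> range f"
      using closure_subset_eq by blast
    define T where "T = {v \<in> sphere 0 1. \<forall>y. (q - f y) \<bullet> v \<ge> \<kappa> * norm (q - f y)}"
    \<comment> \<open>The cone condition is closed in \<open>z\<close>, so it extends to limit
      points of the range.\<close>
    have closure_cone: "(a - z) \<bullet> v \<ge> \<kappa> * norm (a - z)"
      if "\<forall>y. (a - f y) \<bullet> v \<ge> \<kappa> * norm (a - f y)" "z \<in> closure (range f)" for a v z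
    proof -
      have "closed {z. \<kappa> * norm (a - z) \<le> (a - z) \<bullet> v}"
        by (intro closed_Collect_le continuous_intros)
      then show ?thesis
        using that closure_minimal[of "range f" "{z. \<kappa> * norm (a - z) \<le> (a - z) \<bullet> v}"] by blast
    qed
    have "T \<noteq> {}"
    proof -
      \<comment> \<open>Preimages of points near \<open>q\<close> must escape every ball, whose
        image is compact and misses \<open>q\<close>. A limit of their directions will lie in
        \<open>T\<close>.\<close>
      have "\<exists>x. norm x > real n \<and> dist (f x) q < inverse (real (Suc n))" for n
      proof -
        have "closed (f ` cball 0 (real n))"
          by (intro compact_imp_closed compact_continuous_image continuous_on_subset[OF cont]) auto
        moreover have "q \<in> - f ` cball 0 (real n)"
          using q by auto
        ultimately obtain e where e: "e > 0" "ball q e \<subseteq> - f ` cball 0 (real n)"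
          by (meson open_Compl open_contains_ball)
        then have "min e (inverse (real (Suc n))) > 0"
          by simp
        then obtain x where x: "dist (f x) q < min e (inverse (real (Suc n)))"
          using q(1) unfolding closure_approachable by blast
        then have "f x \<in> ball q e"
          by (simp add: dist_commute)
        with e have "x \<notin> cball 0 (real n)"
          by blast
        with x show ?thesis
          by (intro exI[of _ x]) auto
      qed
      then obtain X where X: "\<And>n. norm (X n) > real n" "\<And>n. dist (f (X n)) q < inverse (real (Suc n))"
        by metis
      have "X n \<noteq> 0" for n
        using X(1)[of n] by auto
      then have "\<forall>n. sgn (X n) \<in> sphere 0 1"
        by (simp add: norm_sgn)
      then obtain w r where w: "w \<in> sphere 0 1" "strict_mono r" "((\<lambda>n. sgn (X n)) \<circ> r) \<longlonglongrightarrow> w"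
        by (rule seq_compactE[OF compact_imp_seq_compact[OF compact_sphere]])
      have "filterlim (\<lambda>n. norm (X n)) at_top sequentially"
        using X(1) by (intro filterlim_at_top_mono[OF filterlim_real_sequentially])
          (auto intro: always_eventually less_imp_le)
      then have "filterlim (\<lambda>n. norm (X (r n))) at_top sequentially"
        using filterlim_compose filterlim_subseq[OF w(2)] by blast
      moreover have "(\<lambda>n. f (X n)) \<longlonglongrightarrow> q"
      proof (rule tendsto_dist_iff[THEN iffD2], rule tendsto_sandwich[OF _ _ tendsto_const])
        show "\<forall>\<^sub>F n in sequentially. dist (f (X n)) q \<le> inverse (real (Suc n))"
          using X(2) by (auto intro: always_eventually less_imp_le)
      qed (simp, rule LIMSEQ_inverse_real_of_nat)
      then have "(\<lambda>n. f (X (r n))) \<longlonglongrightarrow> q"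
        using LIMSEQ_subseq_LIMSEQ[OF _ w(2)] by (fastforce simp: o_def)
      ultimately have "(q - f y) \<bullet> w \<ge> \<kappa> * norm (q - f y)" for y
        using w cone_condition_at_infinity[OF mono, of "\<lambda>n. X (r n)" w q y] by (simp add: o_def)
      then show ?thesis
        using w by (auto simp: T_def)
    qed
    \<comment> \<open>Along the ray in direction \<open>w\<close> the values of \<open>f\<close>
      stay bounded, so they accumulate at some \<open>q'\<close>, which satisfies the cone condition
      for \<open>w\<close>. It remains to show \<open>q' = q\<close>.\<close>
    moreover have near: "w \<in> T" if v: "v \<in> T" and w: "norm w = 1" and vw: "dist w v < \<kappa>" for v w
    proof -
      have cone: "\<forall>y. (q - f y) \<bullet> v \<ge> \<kappa> * norm (q - f y)"
        using v by (simp add: T_def)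
      define X where "X k = real (Suc k) *\<^sub>R w" for k
      have norm_X: "norm (X k) = real (Suc k)" and inner_X: "a \<bullet> X k = real (Suc k) * (a \<bullet> w)" for a k
        using w by (simp_all add: X_def)
      \<comment> \<open>The cone around \<open>v\<close> tolerates a perturbation below \<kappa>:
        \<open>f (X k)\<close> cannot pass \<open>q\<close> in direction \<open>w\<close>, although
        monotonicity makes its displacement from \<open>f 0\<close> point that way.\<close>
      have bound: "\<kappa> * norm (f (X k) - f 0) \<le> (q - f 0) \<bullet> w" for k
      proof -
        have "(q - f (X k)) \<bullet> (v - w) \<le> norm (q - f (X k)) * norm (v - w)"
          by (rule norm_cauchy_schwarz)
        also have "\<dots> \<le> norm (q - f (X k)) * \<kappa>"
          using vw by (intro mult_left_mono) (auto simp: dist_norm norm_minus_commute)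
        finally have "(q - f (X k)) \<bullet> v - (q - f (X k)) \<bullet> w \<le> \<kappa> * norm (q - f (X k))"
          by (simp add: inner_diff_right mult.commute)
        moreover have "\<kappa> * norm (q - f (X k)) \<le> (q - f (X k)) \<bullet> v"
          using cone by blast
        ultimately have "(q - f (X k)) \<bullet> w \<ge> 0"
          by linarith
        moreover have "real (Suc k) * (\<kappa> * norm (f (X k) - f 0)) \<le> real (Suc k) * ((f (X k) - f 0) \<bullet> w)"
          using mono[of "X k" 0] norm_X[of k] inner_X[of "f (X k) - f 0" k]
          by (simp only: diff_zero mult.commute)
        then have "\<kappa> * norm (f (X k) - f 0) \<le> (f (X k) - f 0) \<bullet> w"
          by (rule mult_left_le_imp_le) simp
        ultimately show ?thesis
          by (simp add: inner_diff_left)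
      qed
      have "\<forall>k. f (X k) \<in> cball (f 0) ((q - f 0) \<bullet> w / \<kappa>)"
        using bound \<open>\<kappa> > 0\<close> by (simp add: dist_norm norm_minus_commute field_simps)
      then obtain q' r where q': "strict_mono r" "((\<lambda>k. f (X k)) \<circ> r) \<longlonglongrightarrow> q'"
        by (rule seq_compactE[OF compact_imp_seq_compact[OF compact_cball]])
      have "filterlim (\<lambda>k. norm (X k)) at_top sequentially"
        by (intro filterlim_at_top_mono[OF filterlim_real_sequentially] always_eventually)
          (simp add: norm_X)
      then have "filterlim (\<lambda>k. norm (X (r k))) at_top sequentially"
        using filterlim_compose filterlim_subseq[OF q'(1)] by blast
      moreover have "sgn (X k) = w" for k
        using w by (simp add: X_def sgn_div_norm)
      ultimately have cone': "\<forall>y. (q' - f y) \<bullet> w \<ge> \<kappa> * norm (q' - f y)"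
        using w q' cone_condition_at_infinity[OF mono, of "\<lambda>k. X (r k)" w q'] by (simp add: o_def)
      have "q' \<in> closure (range f)"
        unfolding closure_sequential using q'(2) by (intro exI[of _ "(\<lambda>k. f (X k)) \<circ> r"]) auto
      then have 1: "(q - q') \<bullet> v \<ge> \<kappa> * norm (q - q')"
        by (rule closure_cone[OF cone])
      have 2: "(q' - q) \<bullet> w \<ge> \<kappa> * norm (q - q')"
        using closure_cone[OF cone' q(1)] by (simp add: norm_minus_commute)
      \<comment> \<open>Each of \<open>q\<close> and \<open>q'\<close> lies in the cone with apex at
        the other. Adding both inequalities gives a factor 2, which beats
        \<open>norm (v - w) < \<kappa>\<close>.\<close>
      have "2 * \<kappa> * norm (q - q') \<le> (q - q') \<bullet> (v - w)"
        using 1 2 by (simp add: inner_diff_left inner_diff_right)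
      also have "\<dots> \<le> norm (q - q') * norm (v - w)"
        by (rule norm_cauchy_schwarz)
      also have "\<dots> \<le> norm (q - q') * \<kappa>"
        using vw by (intro mult_left_mono) (auto simp: dist_norm norm_minus_commute)
      finally have "\<kappa> * norm (q - q') \<le> 0"
        by (simp add: mult.commute)
      then have "q' = q"
        using \<open>\<kappa> > 0\<close> by (simp add: mult_le_0_iff)
      then show ?thesis
        using cone' w by (simp add: T_def)
    qed
    moreover have "closedin (top_of_set (sphere 0 1)) T"
    proof -
      have "T = sphere 0 1 \<inter> (\<Inter>y. {v. \<kappa> * norm (q - f y) \<le> (q - f y) \<bullet> v})"
        by (auto simp: T_def)
      then show ?thesis
        by (simp add: closedin_closed_Int closed_INT closed_Collect_le continuous_intros)
    qed
    \<comment> \<open>The radius \<kappa> works at every point of \<open>T\<close>.\<close>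
    moreover have "openin (top_of_set (sphere 0 1)) T"
      unfolding openin_euclidean_subtopology_iff
    proof (intro conjI ballI)
      fix v assume "v \<in> T"
      then show "\<exists>e>0. \<forall>w\<in>sphere 0 1. dist w v < e \<longrightarrow> w \<in> T"
        using near \<open>\<kappa> > 0\<close> by (intro exI[of _ \<kappa>]) auto
    qed (auto simp: T_def)
    \<comment> \<open>The dimension bound enters here; in dimension one the sphere is a pair of
      points.\<close>
    moreover have "connected (sphere (0 :: 'a) 1)"
      using dim by (rule connected_sphere)
    ultimately have T: "T = sphere 0 1"
      unfolding connected_clopen by blast
    obtain v :: 'a where "norm v = 1"
      using vector_choose_size[of 1] by auto
    then have "v \<in> T" "- v \<in> T"
      by (simp_all add: T)
    then have "(q - f 0) \<bullet> v \<ge> \<kappa> * norm (q - f 0)" "(q - f 0) \<bullet> (- v) \<ge> \<kappa> * norm (q - f 0)"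
      unfolding T_def by blast+
    then have "\<kappa> * norm (q - f 0) \<le> 0"
      by simp
    then have "q = f 0"
      using \<open>\<kappa> > 0\<close> by (simp add: mult_le_0_iff)
    then show False
      using q by blast
  qed
  ultimately show "surj f"
    using clopen[of "range f"] by auto
qed

section \<open>Bi-Lipschitz bounds and surjectivity for uniformly transverse measures\<close>

theorem theorem3p7:
  fixes \<Omega> :: "(real ^ 'n) set" and \<nu> :: "(real ^ 'n) set measure" and p :: "real ^ 'n"
  assumes "CARD('n) \<ge> 2"
    and "\<Omega> \<noteq> {}" and "open \<Omega>" and "connected \<Omega>" and "convex \<Omega>"
    and "admissible \<Omega> \<nu>"
    and "p \<in> \<Omega>"
    and "uniformly_transverse \<Omega> \<nu>"
  shows "bilipschitz_embedding \<Omega> (dist_of \<nu>) (normal_map \<nu> p) \<and>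
         (\<Omega> = UNIV \<longrightarrow> normal_map \<nu> p ` \<Omega> = UNIV)"
proof -
  let ?f = "normal_map \<nu> p"
  have dim: "DIM(real ^ 'n) \<ge> 2"
    using assms(1) by simp
  note adm = \<open>convex \<Omega>\<close> \<open>admissible \<Omega> \<nu>\<close>
  obtain \<kappa> where \<kappa>: "\<kappa> > 0" "\<And>x y. x \<in> \<Omega> \<Longrightarrow> y \<in> \<Omega> \<Longrightarrow>
      (LINT H:hitting (closed_segment x y)|\<nu>. sin (plane_angle (x - y) H)) \<ge> \<kappa> * dist_of \<nu> x y"
    using assms(8) unfolding uniformly_transverse_def dist_of_def by blast
  have mono: "(?f x - ?f y) \<bullet> (x - y) \<ge> norm (x - y) * (\<kappa> * dist_of \<nu> x y)"
    if "x \<in> \<Omega>" "y \<in> \<Omega>" for x y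
    unfolding inner_normal_map_diff[OF adm dim \<open>p \<in> \<Omega>\<close> that]
    by (intro mult_left_mono \<kappa> that) simp
  have upper: "dist (?f x) (?f y) \<le> dist_of \<nu> x y" if "x \<in> \<Omega>" "y \<in> \<Omega>" for x y
    using dist_normal_map_le[OF adm \<open>p \<in> \<Omega>\<close> that] .
  have lower: "\<kappa> * dist_of \<nu> x y \<le> dist (?f x) (?f y)" if "x \<in> \<Omega>" "y \<in> \<Omega>" for x y
  proof (cases "x = y")
    case True
    then have "dist_of \<nu> x y = 0"
      using assms(6) that by (simp add: dist_of_def admissible_def measure_def)
    then show ?thesis
      by simp
  next
    case False
    \<comment> \<open>Transversality bounds the component along \<open>x - y\<close> from below, and
      Cauchy-Schwarz bounds it from above.\<close>
    have "norm (x - y) * (\<kappa> * dist_of \<nu> x y) \<le> norm (x - y) * norm (?f x - ?f y)"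
      using mono[OF that] norm_cauchy_schwarz[of "?f x - ?f y" "x - y"] by (simp add: mult.commute)
    then show ?thesis
      using False by (simp add: dist_norm)
  qed
  have "bilipschitz_embedding \<Omega> (dist_of \<nu>) ?f"
    unfolding bilipschitz_embedding_def
  \<comment> \<open>The upper bound holds with constant 1 and the lower one with \<kappa>.\<close>
  proof (intro exI[of _ "max 1 (inverse \<kappa>)"] conjI ballI)
    fix x y assume xy: "x \<in> \<Omega>" "y \<in> \<Omega>"
    have nonneg: "dist_of \<nu> x y \<ge> 0"
      by (simp add: dist_of_def)
    have "inverse (max 1 (inverse \<kappa>)) \<le> inverse (inverse \<kappa>)"
      using \<kappa>(1) by (intro le_imp_inverse_le) auto
    then have "inverse (max 1 (inverse \<kappa>)) * dist_of \<nu> x y \<le> \<kappa> * dist_of \<nu> x y"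
      using nonneg by (intro mult_right_mono) auto
    then show "inverse (max 1 (inverse \<kappa>)) * dist_of \<nu> x y \<le> dist (?f x) (?f y)"
      using lower[OF xy] by linarith
    have "1 * dist_of \<nu> x y \<le> max 1 (inverse \<kappa>) * dist_of \<nu> x y"
      using nonneg by (intro mult_right_mono) auto
    then show "dist (?f x) (?f y) \<le> max 1 (inverse \<kappa>) * dist_of \<nu> x y"
      using upper[OF xy] by linarith
  qed simp
  moreover have "surj ?f" if "\<Omega> = UNIV"
  proof (rule strongly_monotone_surj[OF dim \<kappa>(1)])
    show "continuous_on UNIV ?f"
      using continuous_on_normal_map[OF adm \<open>open \<Omega>\<close> \<open>p \<in> \<Omega>\<close>] that by simp
    show "inj ?f"
    proof (rule injI, rule ccontr)
      fix x y assume "?f x = ?f y" "x \<noteq> y"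
      then show False
        using lower[of x y] dist_of_pos[OF adm, of x y] \<kappa>(1) that by (simp add: mult_le_0_iff)
    qed
    fix x y
    \<comment> \<open>The upper Lipschitz bound trades the metric for the Euclidean distance of the
      images, so strong monotonicity holds with the same \<kappa>.\<close>
    have "\<kappa> * norm (?f x - ?f y) * norm (x - y) \<le> \<kappa> * dist_of \<nu> x y * norm (x - y)"
      using upper[of x y] \<kappa>(1) that
      by (intro mult_right_mono mult_left_mono) (auto simp: dist_norm)
    also have "\<dots> \<le> (?f x - ?f y) \<bullet> (x - y)"
      using mono[of x y] that by (simp add: mult.commute)
    finally show "\<kappa> * norm (?f x - ?f y) * norm (x - y) \<le> (?f x - ?f y) \<bullet> (x - y)" .
  qed
  ultimately show ?thesis
    by blast
qed

end
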